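(* Let $\varphi: T\to T$ be a self-map of the rooted tree $T$. If $C_\varphi$ is bounded on $\mathcal{L}_0$, then its operator norm on $\mathcal{L}_0$ satisfies $$1+|\varphi(o)|\le \|C_\varphi\|\le \max\{1+|\varphi(o)|,\lambda_\varphi\},$$ where $\lambda_\varphi$ is the Lipschitz number of $\varphi$.
   Context: $T$ is an infinite, locally finite tree (connected graph without cycles, identified with its vertex set) with a chosen root $o$, in which every vertex except possibly $o$ has degree greater than $1$. $d(v,w)$ is the number of edges of the unique path joining $v$ and $w$, and $|v|=d(o,v)$. $T^*=T\setminus\{o\}$. For $v\in T^*$, the parent $v^-$ is the neighbor of $v$ on the path from $o$ to $v$. The Lipschitz space $\mathcal{L}$ is the set of $f:T\to\mathbb{C}$ with $\sup_{v\in T^*}|f(v)-f(v^-)|<\infty$, a Banach space under $\|f\|_{\mathcal{L}}=\max\{|f(o)|,\sup_{v\in T^*}|f(v)-f(v^-)|\}$. The little Lipschitz space $\mathcal{L}_0$ is the closed subspace of $f\in\mathcal{L}$ with $\lim_{|v|\to\infty}|f(v)-f(v^-)|=0$; the operator norm is taken with respect to $\|\cdot\|_{\mathcal{L}}$. The composition operator is $C_\varphi f=f\circ\varphi$; it is bounded on $\mathcal{L}_0$ if it maps $\mathcal{L}_0$ into itself and is a bounded operator there. The Lipschitz number of $\varphi$ is $\lambda_\varphi=\sup_{v\ne w} d(\varphi(v),\varphi(w))/d(v,w)$ (equivalently $\sup_{v\in T^*}d(\varphi(v),\varphi(v^-))$); it is known to be finite whenever $C_\varphi$ is bounded on $\mathcal{L}_0$.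 *)

theory Defs
  imports Complex_Main "HOL-Library.Extended_Real"
begin

(* A simple graph is given by its adjacency relation E; the vertex set is the whole type 'a,
   so that self-maps of the tree are the functions 'a \<Rightarrow> 'a and complex-valued functions
   on the tree are the functions 'a \<Rightarrow> complex. *)

definition vpath :: "('a \<Rightarrow> 'a \<Rightarrow> bool) \<Rightarrow> 'a \<Rightarrow> 'a \<Rightarrow> 'a list \<Rightarrow> bool" where
  "vpath E u v p \<longleftrightarrow> p \<noteq> [] \<and> hd p = u \<and> last p = v \<and> distinct p \<and> successively E p"

(* Since E is symmetric, traversing one edge back and forth has to be excluded: hence length 3. *)
definition vcycle :: "('a \<Rightarrow> 'a \<Rightarrow> bool) \<Rightarrow> 'a list \<Rightarrow> bool" where
  "vcycle E p \<longleftrightarrow> length p \<ge> 3 \<and> distinct p \<and> successively E p \<and> E (last p) (hd p)"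

locale rooted_tree =
  fixes E :: "'a \<Rightarrow> 'a \<Rightarrow> bool" and r :: 'a
  assumes sym: "E u v \<Longrightarrow> E v u"
    and irrefl: "\<not> E v v"
    and connected: "\<exists>p. vpath E u v p"
    and no_cycles: "\<not> vcycle E p"
    and infinite_vertices: "infinite (UNIV :: 'a set)"
    and locally_finite: "finite {w. E v w}"
    and degree_gt_1: "v \<noteq> r \<Longrightarrow> card {w. E v w} > 1"

(* The descriptions THE below are meaningful because in a tree the path is unique. *)

definition tree_path :: "('a \<Rightarrow> 'a \<Rightarrow> bool) \<Rightarrow> 'a \<Rightarrow> 'a \<Rightarrow> 'a list" where
  "tree_path E u v = (THE p. vpath E u v p)"

definition tree_dist :: "('a \<Rightarrow> 'a \<Rightarrow> bool) \<Rightarrow> 'a \<Rightarrow> 'a \<Rightarrow> nat" where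
  "tree_dist E u v = length (tree_path E u v) - 1"

definition parent :: "('a \<Rightarrow> 'a \<Rightarrow> bool) \<Rightarrow> 'a \<Rightarrow> 'a \<Rightarrow> 'a" where
  "parent E r v = (THE u. E u v \<and> u \<in> set (tree_path E r v))"

definition Lip :: "('a \<Rightarrow> 'a \<Rightarrow> bool) \<Rightarrow> 'a \<Rightarrow> ('a \<Rightarrow> complex) set" where
  "Lip E r = {f. bdd_above ((\<lambda>v. cmod (f v - f (parent E r v))) ` (- {r}))}"

definition lip_norm :: "('a \<Rightarrow> 'a \<Rightarrow> bool) \<Rightarrow> 'a \<Rightarrow> ('a \<Rightarrow> complex) \<Rightarrow> real" where
  "lip_norm E r f =
     max (cmod (f r)) (SUP v\<in>- {r}. cmod (f v - f (parent E r v)))"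

(* The filter filtercomap (tree_dist E r) at_top expresses that the distance from
   the root tends to infinity. *)
definition little_Lip :: "('a \<Rightarrow> 'a \<Rightarrow> bool) \<Rightarrow> 'a \<Rightarrow> ('a \<Rightarrow> complex) set" where
  "little_Lip E r = {f \<in> Lip E r.
     ((\<lambda>v. cmod (f v - f (parent E r v))) \<longlongrightarrow> 0) (filtercomap (tree_dist E r) at_top)}"

definition comp_op :: "('a \<Rightarrow> 'a) \<Rightarrow> ('a \<Rightarrow> complex) \<Rightarrow> ('a \<Rightarrow> complex)" where
  "comp_op \<phi> f = f \<circ> \<phi>"

(* For linear operators A, such as comp_op \<phi>; linearity is not part of the definition. *)
definition bounded_on_little_Lip ::
    "('a \<Rightarrow> 'a \<Rightarrow> bool) \<Rightarrow> 'a \<Rightarrow> (('a \<Rightarrow> complex) \<Rightarrow> ('a \<Rightarrow> complex)) \<Rightarrow> bool" where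
  "bounded_on_little_Lip E r A \<longleftrightarrow>
     (\<forall>f\<in>little_Lip E r. A f \<in> little_Lip E r) \<and>
     (\<exists>K. \<forall>f\<in>little_Lip E r. lip_norm E r (A f) \<le> K * lip_norm E r f)"

(* The usual operator norm if A is bounded (the supremum of an unbounded set of reals is
   unspecified). *)
definition little_Lip_onorm ::
    "('a \<Rightarrow> 'a \<Rightarrow> bool) \<Rightarrow> 'a \<Rightarrow> (('a \<Rightarrow> complex) \<Rightarrow> ('a \<Rightarrow> complex)) \<Rightarrow> real" where
  "little_Lip_onorm E r A =
     (SUP f\<in>{f \<in> little_Lip E r. lip_norm E r f \<le> 1}. lip_norm E r (A f))"

(* Extended-real valued, as the supremum is infinite for general \<phi>. *)
definition lip_number :: "('a \<Rightarrow> 'a \<Rightarrow> bool) \<Rightarrow> ('a \<Rightarrow> 'a) \<Rightarrow> ereal" where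
  "lip_number E \<phi> =
     (SUP (v, w)\<in>{(v, w). v \<noteq> w}.
        ereal (real (tree_dist E (\<phi> v) (\<phi> w)) / real (tree_dist E v w)))"

end

theory Submission
  imports Defs
begin

text \<open>
  A function whose differences along edges are at most 1 changes by at most \<open>d(v, w)\<close> between
  \<open>v\<close> and \<open>w\<close>; applied to the pairs \<open>(o, \<phi>(o))\<close> and \<open>(\<phi>(v), \<phi>(v\<^sup>-))\<close>, this gives the upper bound.
  The lower bound comes from the test function \<open>f(v) = 1 + min |v| |\<phi>(o)|\<close>, which has norm 1
  and finitely many levels on which its differences do not vanish.
\<close>

lemma norm_diff_along_successively:
  fixes f :: "'a \<Rightarrow> 'b :: real_normed_vector"
  assumes "successively E p" "p \<noteq> []"
    and "\<And>u w. E u w \<Longrightarrow> norm (f u - f w) \<le> B"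
  shows "norm (f (hd p) - f (last p)) \<le> real (length p - 1) * B"
  using assms(1,2)
proof (induction p rule: induct_list012)
  case (3 x y zs)
  have "norm (f x - f (last (y # zs))) \<le> norm (f x - f y) + norm (f y - f (last (y # zs)))"
    using norm_triangle_ineq[of "f x - f y" "f y - f (last (y # zs))"] by simp
  also have "\<dots> \<le> B + real (length zs) * B"
  proof (rule add_mono)
    show "norm (f x - f y) \<le> B" using 3 assms(3) by simp
    show "norm (f y - f (last (y # zs))) \<le> real (length zs) * B" using 3 by simp
  qed
  finally show ?case by (simp add: algebra_simps)
qed auto

context rooted_tree
begin

section \<open>Paths in the tree and their uniqueness\<close>

lemma vpath_singleton: "vpath E u u [u]"
  by (simp add: vpath_def)

lemma vpath_same: "vpath E u u p \<Longrightarrow> p = [u]"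
  by (cases p) (auto simp: vpath_def split: if_splits)

lemma vpath_ends: "vpath E u v p \<Longrightarrow> u \<in> set p" "vpath E u v p \<Longrightarrow> v \<in> set p"
  by (metis vpath_def hd_in_set) (metis vpath_def last_in_set)

lemma vpath_ConsD:
  assumes "vpath E u v (u # p)" "p \<noteq> []"
  shows "vpath E (hd p) v p" "E u (hd p)" "u \<notin> set p"
  using assms by (simp_all add: vpath_def successively_Cons)

lemma successively_adj_rev: "successively E (rev xs) \<longleftrightarrow> successively E xs"
proof -
  have eq: "(\<lambda>x y. E y x) = E" using sym by blast
  show ?thesis using successively_rev[of E xs] unfolding eq .
qed

text \<open>This is what makes the \<open>THE\<close> in \<open>tree_path\<close> meaningful. By
  induction along the first path: a common first edge is stripped from both paths, while different
  first edges would produce a cycle.\<close>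

lemma vpath_unique:
  assumes "vpath E u v p" "vpath E u v q"
  shows "p = q"
  using assms
proof (induction p arbitrary: u q)
  case Nil
  then show ?case by (simp add: vpath_def)
next
  case (Cons u' p)
  have u': "u' = u" using Cons.prems(1) by (simp add: vpath_def)
  obtain q' where q: "q = u # q'"
    using Cons.prems(2) by (cases q) (auto simp: vpath_def)
  show ?case
  proof (cases "p = [] \<or> q' = []")
    case True
    then have "u = v" using Cons.prems u' q by (elim disjE) (simp_all add: vpath_def)
    then show ?thesis using Cons.prems vpath_same by blast
  next
    case False
    then have ne: "p \<noteq> []" "q' \<noteq> []" by auto
    note P = vpath_ConsD[OF Cons.prems(1)[unfolded u'] ne(1)]
    note Q = vpath_ConsD[OF Cons.prems(2)[unfolded q] ne(2)]
    show ?thesis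
    proof (cases "hd p = hd q'")
      case True
      then show ?thesis using Cons.IH[OF P(1)] Q(1) u' q by simp
    next
      case neq: False
      txt \<open>The two paths diverge at \<open>u\<close>; closing them up at the first vertex \<open>x\<close> where they meet
        again yields a cycle.\<close>
      have "v \<in> set p" "v \<in> set q'"
        using P(1) Q(1) vpath_ends by blast+
      then have "\<exists>x\<in>set p. x \<in> set q'" by blast
      then obtain a x b where a: "p = a @ x # b" "x \<in> set q'" "\<forall>y\<in>set a. y \<notin> set q'"
        by (rule split_list_first_propE)
      obtain c d where c: "q' = c @ x # d" using a(2) by (meson split_list)
      have "successively E (a @ x # b)" "successively E (c @ x # d)"
        and distinct: "distinct (a @ x # b)" "distinct (c @ x # d)"
        using P(1) Q(1) by (simp_all only: a(1) c vpath_def)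
      then have sc: "successively E (a @ [x])" "successively E (c @ [x])"
        unfolding successively_append_iff by simp_all
      have hds: "hd (a @ [x]) = hd p" "hd (c @ [x]) = hd q'"
        unfolding a(1) c hd_append by simp_all
      have "successively E (x # rev c)"
        using successively_adj_rev[of "c @ [x]"] sc(2) by simp
      then have "successively E (a @ x # rev c)"
        using sc(1) by (auto simp: successively_append_iff)
      moreover have "hd (a @ x # rev c) = hd p" using a(1) by (simp add: hd_append)
      ultimately have "successively E (u # a @ x # rev c)"
        using P(2) by (simp add: successively_Cons)
      moreover have "E (last (x # rev c)) u"
        using sym[OF Q(2)] hds(2) by (cases c) simp_all
      \<comment> \<open>By the choice of \<open>x\<close> as first meeting point, \<open>a\<close>
        avoids all of \<open>q'\<close> and hence \<open>c\<close>.\<close>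
      moreover have "distinct (u # a @ x # rev c)"
        using distinct P(3) Q(3) a c by auto
      \<comment> \<open>If \<open>a\<close> and \<open>c\<close> were both empty, both paths would
        continue from \<open>u\<close> to \<open>x\<close>, against \<open>neq\<close>.\<close>
      moreover have "a \<noteq> [] \<or> c \<noteq> []" using neq hds by auto
      then have "length (u # a @ x # rev c) \<ge> 3" by (cases a; cases c) auto
      ultimately have "vcycle E (u # a @ x # rev c)" by (simp add: vcycle_def)
      then show ?thesis using no_cycles by blast
    qed
  qed
qed

lemma vpath_tree_path: "vpath E u v (tree_path E u v)"
  unfolding tree_path_def using connected vpath_unique by (metis theI)

lemma tree_path_eq: "vpath E u v p \<Longrightarrow> tree_path E u v = p"
  using vpath_tree_path vpath_unique by blast

section \<open>Distances, parents and edges\<close>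

lemma tree_dist_same: "tree_dist E u u = 0"
  by (simp add: tree_dist_def tree_path_eq[OF vpath_singleton])

lemma tree_dist_adjacent:
  assumes "E u v"
  shows "tree_dist E u v = 1"
proof -
  have "vpath E u v [u, v]" using assms irrefl by (auto simp: vpath_def)
  then show ?thesis by (simp add: tree_dist_def tree_path_eq)
qed

lemma tree_path_snoc:
  assumes "E u v" "v \<notin> set (tree_path E w u)"
  shows "tree_path E w v = tree_path E w u @ [v]"
  using assms vpath_tree_path[of w u]
  by (intro tree_path_eq) (auto simp: vpath_def successively_append_iff)

text \<open>The part of the path up to \<open>u\<close> is the path to \<open>u\<close>, and it
  misses \<open>v\<close>, which comes last. Extending it by the edge to \<open>v\<close> gives a
  path, so by uniqueness nothing lies between \<open>u\<close> and \<open>v\<close>. Hence a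
  neighbor of \<open>v\<close> on the path from the root can only be its penultimate vertex.\<close>

lemma adjacent_on_tree_path:
  assumes "E u v" "u \<in> set (tree_path E w v)"
  shows "tree_path E w v = tree_path E w u @ [v]"
proof -
  note P = vpath_tree_path[of w v]
  obtain a b where ab: "tree_path E w v = a @ u # b" using assms(2) by (meson split_list)
  have v: "v = last (u # b)" and dist: "distinct (a @ u # b)"
    using P ab by (simp_all add: vpath_def)
  have "vpath E w u (a @ [u])"
    using P ab by (simp add: vpath_def successively_append_iff hd_append split: if_splits)
  then have "tree_path E w u = a @ [u]" by (rule tree_path_eq)
  moreover have "v \<noteq> u" using assms(1) irrefl by blast
  then have "v \<in> set b" using v by (simp split: if_splits)
  then have "v \<notin> set (a @ [u])" using dist by auto
  ultimately show ?thesis using assms(1) by (simp add: tree_path_snoc)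
qed

lemma parent_eqI:
  assumes "E u v" "u \<in> set (tree_path E r v)"
  shows "parent E r v = u"
  unfolding parent_def
proof (rule the_equality)
  fix w assume "E w v \<and> w \<in> set (tree_path E r v)"
  then have "tree_path E r w = tree_path E r u"
    using adjacent_on_tree_path assms by (metis append1_eq_conv)
  then show "w = u" using vpath_tree_path by (metis vpath_def)
qed (use assms in blast)

lemma parent_props:
  assumes "v \<noteq> r"
  shows "E (parent E r v) v" "tree_dist E r v = Suc (tree_dist E r (parent E r v))"
proof -
  note P = vpath_tree_path[of r v]
  obtain a where a: "tree_path E r v = a @ [v]"
    using P by (metis append_butlast_last_id vpath_def)
  then have ne: "a \<noteq> []" using P assms by (auto simp: vpath_def)
  then have u: "E (last a) v" "last a \<in> set (tree_path E r v)"
    using P a by (auto simp: vpath_def successively_append_iff)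
  then have eq: "parent E r v = last a" by (rule parent_eqI)
  then show "E (parent E r v) v" using u by simp
  \<comment> \<open>Distances are natural numbers obtained by subtracting 1, so the successor
    relation needs a nonempty path.\<close>
  have "tree_path E r (last a) \<noteq> []" using vpath_tree_path by (metis vpath_def)
  then show "tree_dist E r v = Suc (tree_dist E r (parent E r v))"
    using adjacent_on_tree_path[OF u] eq by (simp add: tree_dist_def)
qed

text \<open>Either \<open>v\<close> lies on the path from the root to \<open>u\<close>, or appending
  \<open>v\<close> to that path gives the path to \<open>v\<close>, which then contains
  \<open>u\<close>. So bounds on differences to the parent are bounds on all edges.\<close>

lemma adjacent_parent_cases:
  assumes "E u v"
  shows "v \<noteq> r \<and> parent E r v = u \<or> u \<noteq> r \<and> parent E r u = v"
proof (cases "v \<in> set (tree_path E r u)")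
  case True
  moreover have "u \<noteq> r"
    using True tree_path_eq[OF vpath_singleton] assms irrefl by auto
  ultimately show ?thesis using parent_eqI sym assms by blast
next
  case False
  have "u \<in> set (tree_path E r u)" "r \<in> set (tree_path E r u)"
    using vpath_ends vpath_tree_path by blast+
  moreover from this have "u \<in> set (tree_path E r v)"
    using tree_path_snoc[OF assms False] by simp
  ultimately show ?thesis using parent_eqI assms False by blast
qed

text \<open>Guards the real-valued supremum in \<open>lip_norm\<close>, which would be unspecified
  over an empty set.\<close>

lemma nonroot_nonempty: "- {r} \<noteq> {}"
proof
  assume "- {r} = {}"
  then have "UNIV = {r}" by auto
  then show False using infinite_vertices by (metis finite.emptyI finite.insertI)
qed

lemma norm_diff_le_tree_dist:
  fixes f :: "'a \<Rightarrow> 'b :: real_normed_vector"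
  assumes "\<And>v. v \<noteq> r \<Longrightarrow> norm (f v - f (parent E r v)) \<le> B"
  shows "norm (f u - f w) \<le> real (tree_dist E u w) * B"
proof -
  have "norm (f x - f y) \<le> B" if "E x y" for x y
    using adjacent_parent_cases[OF that] assms by (metis norm_minus_commute)
  then show ?thesis
    using norm_diff_along_successively[of E "tree_path E u w" f B] vpath_tree_path[of u w]
    by (auto simp: vpath_def tree_dist_def)
qed

section \<open>The Lipschitz norm, the little Lipschitz space and the operator norm\<close>

lemma lip_norm_leI:
  assumes "cmod (f r) \<le> B" "\<And>v. v \<noteq> r \<Longrightarrow> cmod (f v - f (parent E r v)) \<le> B"
  shows "lip_norm E r f \<le> B"
  unfolding lip_norm_def using assms nonroot_nonempty by (auto intro!: cSUP_least)

lemma norm_root_le_lip_norm: "cmod (f r) \<le> lip_norm E r f"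
  by (simp add: lip_norm_def)

lemma norm_diff_parent_le_lip_norm:
  assumes "f \<in> Lip E r" "v \<noteq> r"
  shows "cmod (f v - f (parent E r v)) \<le> lip_norm E r f"
  using assms unfolding Lip_def lip_norm_def
  by (intro max.coboundedI2 cSUP_upper) auto

lemma little_LipI_eventually_const:
  assumes "\<And>v. v \<noteq> r \<Longrightarrow> cmod (f v - f (parent E r v)) \<le> B"
    and "\<And>v. tree_dist E r v > n \<Longrightarrow> f v = f (parent E r v)"
  shows "f \<in> little_Lip E r"
proof -
  have "\<forall>\<^sub>F v in filtercomap (tree_dist E r) at_top. tree_dist E r v > n"
    by (intro eventually_filtercomapI eventually_gt_at_top)
  then have "\<forall>\<^sub>F v in filtercomap (tree_dist E r) at_top. cmod (f v - f (parent E r v)) = 0"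
    by eventually_elim (use assms(2) in simp)
  then have "((\<lambda>v. cmod (f v - f (parent E r v))) \<longlongrightarrow> 0) (filtercomap (tree_dist E r) at_top)"
    by (rule tendsto_eventually)
  moreover have "f \<in> Lip E r" unfolding Lip_def using assms(1) by (auto intro!: bdd_aboveI)
  ultimately show ?thesis by (simp add: little_Lip_def)
qed

lemma little_Lip_onorm_upper:
  assumes "bounded_on_little_Lip E r A" "f \<in> little_Lip E r" "lip_norm E r f \<le> 1"
  shows "lip_norm E r (A f) \<le> little_Lip_onorm E r A"
proof -
  obtain K where K: "\<And>g. g \<in> little_Lip E r \<Longrightarrow> lip_norm E r (A g) \<le> K * lip_norm E r g"
    using assms(1) unfolding bounded_on_little_Lip_def by blast
  \<comment> \<open>The set under the supremum must be bounded above. The absolute value covers a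
    negative \<open>K\<close>, for which multiplying by a norm below 1 would not keep the bound
    \<open>K\<close>.\<close>
  have "lip_norm E r (A g) \<le> \<bar>K\<bar>" if "g \<in> little_Lip E r" "lip_norm E r g \<le> 1" for g
  proof -
    have "0 \<le> lip_norm E r g" using norm_root_le_lip_norm norm_ge_zero order_trans by blast
    then have "K * lip_norm E r g \<le> \<bar>K\<bar> * 1" using that by (intro mult_mono) auto
    then show ?thesis using K[OF that(1)] by simp
  qed
  then show ?thesis
    unfolding little_Lip_onorm_def using assms by (intro cSUP_upper bdd_aboveI) auto
qed

lemma little_Lip_onorm_leI:
  assumes "\<And>f. f \<in> little_Lip E r \<Longrightarrow> lip_norm E r f \<le> 1 \<Longrightarrow> lip_norm E r (A f) \<le> M"
  shows "little_Lip_onorm E r A \<le> M"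
  unfolding little_Lip_onorm_def
proof (rule cSUP_least)
  have "(\<lambda>_. 0) \<in> little_Lip E r" by (rule little_LipI_eventually_const) auto
  moreover have "lip_norm E r (\<lambda>_. 0) \<le> 1" by (rule lip_norm_leI) auto
  ultimately show "{f \<in> little_Lip E r. lip_norm E r f \<le> 1} \<noteq> {}" by blast
qed (use assms in auto)

text \<open>On an edge the denominator of the Lipschitz quotient is 1.\<close>

lemma tree_dist_le_lip_number:
  assumes "E v w"
  shows "ereal (real (tree_dist E (\<phi> v) (\<phi> w))) \<le> lip_number E \<phi>"
proof -
  have "(v, w) \<in> {(v, w). v \<noteq> w}" using assms irrefl by auto
  from SUP_upper[OF this, of "\<lambda>(v, w). ereal (real (tree_dist E (\<phi> v) (\<phi> w)) / real (tree_dist E v w))"]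
  show ?thesis by (simp add: lip_number_def tree_dist_adjacent[OF assms])
qed

section \<open>The two bounds for the composition operator\<close>

lemma onorm_comp_op_lower:
  assumes "bounded_on_little_Lip E r (comp_op \<phi>)"
  shows "1 + real (tree_dist E r (\<phi> r)) \<le> little_Lip_onorm E r (comp_op \<phi>)"
proof -
  define n where "n = tree_dist E r (\<phi> r)"
  define f :: "'a \<Rightarrow> complex" where "f v = of_nat (Suc (min (tree_dist E r v) n))" for v
  have diff: "cmod (f v - f (parent E r v)) \<le> 1" if "v \<noteq> r" for v
  proof -
    let ?k = "min (tree_dist E r v) n" and ?l = "min (tree_dist E r (parent E r v)) n"
    have "?k = ?l \<or> ?k = Suc ?l" unfolding parent_props(2)[OF that] by (simp add: min_def)
    then show ?thesis unfolding f_def by (elim disjE) simp_all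
  qed
  \<comment> \<open>Beyond level \<open>n\<close> the parent still has level at least
    \<open>n\<close>, so the minimum is \<open>n\<close> at both vertices.\<close>
  have const: "f v = f (parent E r v)" if "tree_dist E r v > n" for v
  proof -
    have "v \<noteq> r" using that tree_dist_same by auto
    then show ?thesis using parent_props(2) that by (auto simp: f_def min_def)
  qed
  have "f \<in> little_Lip E r" using diff const by (rule little_LipI_eventually_const)
  moreover have "lip_norm E r f \<le> 1"
    using diff by (intro lip_norm_leI) (simp_all add: f_def tree_dist_same)
  ultimately have "lip_norm E r (comp_op \<phi> f) \<le> little_Lip_onorm E r (comp_op \<phi>)"
    by (rule little_Lip_onorm_upper[OF assms])
  \<comment> \<open>At \<open>\<phi> r\<close> the level is exactly \<open>n\<close>, so the test
    function attains its maximal value there.\<close>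
  moreover have "cmod (comp_op \<phi> f r) = real (Suc n)"
    by (simp only: comp_op_def f_def o_def n_def min.idem norm_of_nat)
  ultimately show ?thesis using norm_root_le_lip_norm[of "comp_op \<phi> f"] by (simp add: n_def)
qed

text \<open>If the maximum is infinite there is nothing to show. Otherwise it is a real
  \<open>M\<close>, and each of the two parts of the norm of the image of a unit-ball function is
  compared with \<open>M\<close>.\<close>

lemma onorm_comp_op_upper:
  "ereal (little_Lip_onorm E r (comp_op \<phi>))
     \<le> max (ereal (1 + real (tree_dist E r (\<phi> r)))) (lip_number E \<phi>)" (is "_ \<le> ?M")
proof (cases ?M)
  case (real M)
  have M: "1 + real (tree_dist E r (\<phi> r)) \<le> M"
    using max.cobounded1[of "ereal (1 + real (tree_dist E r (\<phi> r)))" "lip_number E \<phi>"]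
    unfolding real by simp
  have L: "real (tree_dist E (\<phi> v) (\<phi> w)) \<le> M" if "E v w" for v w
  proof -
    have "ereal (real (tree_dist E (\<phi> v) (\<phi> w))) \<le> ?M"
      using tree_dist_le_lip_number[OF that] by (rule max.coboundedI2)
    then show ?thesis unfolding real by simp
  qed
  have "little_Lip_onorm E r (comp_op \<phi>) \<le> M"
  proof (rule little_Lip_onorm_leI)
    fix f assume f: "f \<in> little_Lip E r" "lip_norm E r f \<le> 1"
    then have "f \<in> Lip E r" by (simp add: little_Lip_def)
    then have "cmod (f v - f (parent E r v)) \<le> 1" if "v \<noteq> r" for v
      using norm_diff_parent_le_lip_norm that f(2) by (metis order_trans)
    then have d: "cmod (f u - f w) \<le> real (tree_dist E u w)" for u w
      using norm_diff_le_tree_dist[of f 1 u w] by simp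
    show "lip_norm E r (comp_op \<phi> f) \<le> M"
    proof (rule lip_norm_leI)
      \<comment> \<open>The root value contributes at most 1 and the path from \<open>r\<close> to
        \<open>\<phi> r\<close> at most its length.\<close>
      have "cmod (f (\<phi> r)) \<le> cmod (f r) + cmod (f r - f (\<phi> r))"
        by (metis norm_triangle_sub norm_minus_commute)
      then show "cmod (comp_op \<phi> f r) \<le> M"
        using d[of r "\<phi> r"] norm_root_le_lip_norm[of f] f(2) M by (simp add: comp_op_def)
    next
      fix v assume "v \<noteq> r"
      then have "real (tree_dist E (\<phi> v) (\<phi> (parent E r v))) \<le> M"
        using L sym parent_props(1) by blast
      then show "cmod (comp_op \<phi> f v - comp_op \<phi> f (parent E r v)) \<le> M"
        using d[of "\<phi> v" "\<phi> (parent E r v)"] by (simp add: comp_op_def)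
    qed
  qed
  then show ?thesis using real by simp
next
  \<comment> \<open>Impossible, since one argument of the maximum is a real number.\<close>
  case MInf
  then show ?thesis by (simp add: max_def split: if_splits)
qed simp

end

theorem theorem3p7:
  fixes E :: "'a \<Rightarrow> 'a \<Rightarrow> bool" and r :: 'a and \<phi> :: "'a \<Rightarrow> 'a"
  assumes "rooted_tree E r"
    and "bounded_on_little_Lip E r (comp_op \<phi>)"
  shows "1 + real (tree_dist E r (\<phi> r)) \<le> little_Lip_onorm E r (comp_op \<phi>)
    \<and> ereal (little_Lip_onorm E r (comp_op \<phi>))
        \<le> max (ereal (1 + real (tree_dist E r (\<phi> r)))) (lip_number E \<phi>)"
  using rooted_tree.onorm_comp_op_lower[OF assms]
    rooted_tree.onorm_comp_op_upper[OF assms(1)] by blast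

end
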